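(* The Peano continuum $A\subset\mathbb{R}^3$ (the rotated topologist's sine curve with central limit arc and connecting arcs, constructed in the context) is not $\pi_1$-shape injective.
   Context: Construction of $A$. Use cylindrical coordinates $(r,\varphi,z)$ on $\mathbb{R}^3$ and fix $r_0>0$. The surface is $S=\{(r,\varphi,z): 0<r\le r_0,\ \varphi\in\mathbb{R}/2\pi\mathbb{Z},\ z=\sin(1/r)\}$, i.e. the topologist's sine curve rotated about its limiting arc. The central limit arc is $L=\{(0,\varphi,z): -1\le z\le 1\}$ (the point $(0,\varphi,z)$ does not depend on $\varphi$). The connecting arcs are a null sequence of horizontal segments lying in a countable dense set of radial cross sections, joining the central limit arc to the surface: $\sigma_n=\{(r,\varphi_n,z_n): 0\le r\le r_n\}$, $n\ge 1$, where $0<r_n\le r_0$, $r_n\to 0$, $z_n=\sin(1/r_n)$, and the set of pairs $\{(\varphi_n,z_n)\}$ is dense in $(\mathbb{R}/2\pi\mathbb{Z})\times[-1,1]$. Put $A=S\cup L\cup\bigcup_{n}\sigma_n$ with the subspace topology from $\mathbb{R}^3$. The connecting arcs make $A$ locally path connected, so $A$ is a Peano continuum (compact, connected, locally connected metric space). A loop in a space is nulhomotopic (inessential) if it extends, as a map from $S^1$, to a map from the closed disc $B^2$; otherwise it is essential. A space $X$ is $\pi_1$-shape injective (or shape injective) if there is an absolute retract $R$ containing $X$ as a closed subspace such that for every essential closed curve $\gamma$ in $X$ there is a neighborhood $V$ of $X$ in $R$ such that $\gamma$ is essential in $V$. (This condition does not depend on the choice of the absolute retract $R$ containing $X$ as a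 closed subspace; for subspaces of $\mathbb{R}^3$ one may take $R=\mathbb{R}^3$.) *)

theory Defs
  imports "HOL-Analysis.Analysis"
begin

text \<open>Closed curves are maps on the unit circle of \<open>complex\<close>; the disc is \<open>cball 0 1\<close>.\<close>

definition closed_curve_in :: "'a topology \<Rightarrow> (complex \<Rightarrow> 'a) \<Rightarrow> bool" where
  "closed_curve_in X \<gamma> \<longleftrightarrow> continuous_map (top_of_set (sphere 0 1)) X \<gamma>"

definition nulhomotopic_in :: "'a topology \<Rightarrow> (complex \<Rightarrow> 'a) \<Rightarrow> bool" where
  "nulhomotopic_in X \<gamma> \<longleftrightarrow>
     (\<exists>g. continuous_map (top_of_set (cball 0 1)) X g \<and> (\<forall>t \<in> sphere 0 1. g t = \<gamma> t))"

definition essential_in :: "'a topology \<Rightarrow> (complex \<Rightarrow> 'a) \<Rightarrow> bool" where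
  "essential_in X \<gamma> \<longleftrightarrow> closed_curve_in X \<gamma> \<and> \<not> nulhomotopic_in X \<gamma>"

text \<open>
  Absolute retracts for the class of metrizable spaces. The constant \<open>AR\<close> of \<open>HOL-Analysis\<close> is
  meant for subsets of Euclidean spaces only. The test spaces \<open>Y\<close> have to live on a fixed type;
  \<open>'b \<Rightarrow> real\<close> is large enough to give the usual notion: by the Kuratowski-Wojdyslawski
  theorem, \<open>R\<close> is homeomorphic to a closed subset of a convex subset of the bounded real
  functions on \<open>R\<close> (with the supremum metric). A retraction of that convex set onto the copy
  of \<open>R\<close> makes \<open>R\<close> an absolute extensor for all metrizable spaces, by Dugundji's extension
  theorem, and hence a retract of every metrizable space containing it as a closed subspace.
\<close>

definition absolute_retract :: "'b topology \<Rightarrow> bool" where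
  "absolute_retract R \<longleftrightarrow>
     metrizable_space R \<and>
     (\<forall>(Y :: ('b \<Rightarrow> real) topology) e.
        metrizable_space Y \<and> embedding_map R Y e \<and> closedin Y (e ` topspace R)
        \<longrightarrow> (e ` topspace R) retract_of_space Y)"

definition neighbourhood_in_space :: "'b topology \<Rightarrow> 'b set \<Rightarrow> 'b set \<Rightarrow> bool" where
  "neighbourhood_in_space R C V \<longleftrightarrow> V \<subseteq> topspace R \<and> (\<exists>U. openin R U \<and> C \<subseteq> U \<and> U \<subseteq> V)"

text \<open>
  HOL cannot quantify over the type carrying the absolute retract \<open>R\<close>, so that type is an
  argument. A space is not shape injective iff this predicate fails at every type \<open>'b\<close>.
  The inclusion of \<open>X\<close> in \<open>R\<close> as a closed subspace is the closed embedding \<open>e\<close>.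
\<close>

definition shape_injective :: "'b itself \<Rightarrow> 'a topology \<Rightarrow> bool" where
  "shape_injective (_ :: 'b itself) X \<longleftrightarrow>
     (\<exists>(R :: 'b topology) e.
        absolute_retract R \<and> embedding_map X R e \<and> closedin R (e ` topspace X) \<and>
        (\<forall>\<gamma>. essential_in X \<gamma> \<longrightarrow>
           (\<exists>V. neighbourhood_in_space R (e ` topspace X) V \<and>
                essential_in (subtopology R V) (e \<circ> \<gamma>))))"

definition cyl :: "real \<Rightarrow> real \<Rightarrow> real \<Rightarrow> real ^ 3" where
  "cyl r \<phi> z = vector [r * cos \<phi>, r * sin \<phi>, z]"

definition sine_surface :: "real \<Rightarrow> (real ^ 3) set" where
  "sine_surface r0 = {cyl r \<phi> (sin (1 / r)) | r \<phi>. 0 < r \<and> r \<le> r0}"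

definition limit_arc :: "(real ^ 3) set" where
  "limit_arc = {cyl 0 \<phi> z | \<phi> z. -1 \<le> z \<and> z \<le> 1}"

definition connecting_arc :: "real \<Rightarrow> real \<Rightarrow> (real ^ 3) set" where
  "connecting_arc \<rho> \<phi> = {cyl r \<phi> (sin (1 / \<rho>)) | r. 0 \<le> r \<and> r \<le> \<rho>}"

text \<open>
  The data of the connecting arcs: the n-th arc has length \<open>\<rho> n\<close>, angle \<open>\<phi> n\<close> and height
  \<open>sin (1 / \<rho> n)\<close>. The circle of angles (reals modulo \<open>2 * pi\<close>) is identified with the unit
  circle of \<open>complex\<close> by \<open>cis\<close>.
\<close>

definition arc_data :: "real \<Rightarrow> (nat \<Rightarrow> real) \<Rightarrow> (nat \<Rightarrow> real) \<Rightarrow> bool" where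
  "arc_data r0 \<rho> \<phi> \<longleftrightarrow>
     (\<forall>n\<ge>1. 0 < \<rho> n \<and> \<rho> n \<le> r0) \<and> \<rho> \<longlonglongrightarrow> 0 \<and>
     closure {(cis (\<phi> n), sin (1 / \<rho> n)) | n. n \<ge> 1} = sphere 0 1 \<times> {-1..1}"

definition space_A :: "real \<Rightarrow> (nat \<Rightarrow> real) \<Rightarrow> (nat \<Rightarrow> real) \<Rightarrow> (real ^ 3) set" where
  "space_A r0 \<rho> \<phi> =
     sine_surface r0 \<union> limit_arc \<union> (\<Union>n\<in>{1..}. connecting_arc (\<rho> n) (\<phi> n))"

end

theory Submission
  imports Defs
begin

text \<open>
  The closed curve that witnesses the failure of shape injectivity is the outer boundary circle of
  the surface: radius \<open>r0\<close>, height \<open>sin (1 / r0)\<close>.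

  It is inessential in every neighbourhood \<open>V\<close> of the space in an absolute retract \<open>R\<close>. Inside the
  surface it is homotopic to the circle of radius \<open>r1 = 1 / (n * pi)\<close>, which for large \<open>n\<close> lies close
  to the origin, a point of the limit arc. An absolute retract contracts to any of its points
  keeping that point fixed (\<open>absolute_retract_contracts_to_point\<close>), so loops close to the point
  shrink to it inside \<open>V\<close>.

  It is essential in the space itself (\<open>outer_circle_not_nulhomotopic\<close>). Suppose that it extends to a
  map \<open>g\<close> of the disc, and let \<open>F\<close> be the horizontal part of \<open>g\<close>, a map into the plane of degree one on
  the boundary. Call a region of the disc essential if \<open>F\<close> cannot be replaced on it, relative to its
  frontier, by a nowhere vanishing map; by the no-retraction theorem the open disc is essential. Let
  \<open>p k\<close> decrease to \<open>0\<close> along the radii where \<open>sin (1 / r)\<close> is alternately \<open>1\<close> and \<open>-1\<close>. The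
  points of the space at distance \<open>p k\<close> from the axis form a circle of the surface together with
  finitely many points on connecting arcs. The latter carry no winding, because \<open>F\<close> takes finitely many
  values there. Hence each essential region contains a smaller one whose frontier is mapped by \<open>g\<close> into
  the circle of the next radius (\<open>essential_region_descent\<close>). The height of \<open>g\<close> on consecutive
  frontiers differs by \<open>2\<close>, so by uniform continuity these frontiers keep a fixed distance
  \<open>\<delta>\<close> from each other. A bounded set has no room for infinitely many nested regions of this kind
  (\<open>no_uniformly_separated_nest\<close>).
\<close>

section \<open>Regions of the plane on which a map must vanish\<close>

definition essential_region :: "(complex \<Rightarrow> complex) \<Rightarrow> complex set \<Rightarrow> bool" where
  "essential_region F B \<longleftrightarrow>
     (\<nexists>h. continuous_on (closure B) h \<and> (\<forall>x \<in> closure B. h x \<noteq> 0) \<and> (\<forall>x \<in> frontier B. h x = F x))"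

definition has_log_on :: "complex set \<Rightarrow> (complex \<Rightarrow> complex) \<Rightarrow> bool" where
  "has_log_on S F \<longleftrightarrow> (\<exists>l. continuous_on S l \<and> (\<forall>x \<in> S. F x = exp (l x)))"

text \<open>
  Having a logarithm means being homotopic to a constant in the punctured plane. The punctured plane is
  an ANR, so on a compact set such a homotopy can be extended from each component to a clopen
  neighbourhood of it, and finitely many of these cover the set.
\<close>

lemma has_log_on_componentwise:
  assumes "compact S" and F: "continuous_on S F" "\<And>x. x \<in> S \<Longrightarrow> F x \<noteq> 0"
    and log: "\<And>C. C \<in> components S \<Longrightarrow> has_log_on C F"
  shows "has_log_on S F"
proof -
  have anr: "ANR (-{0::complex})"
    by (simp add: ANR_delete open_Compl open_imp_ANR)
  have "homotopic_with_canon (\<lambda>x. True) C (-{0}) F (\<lambda>x. 1)" if C: "C \<in> components S" for C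
  proof -
    obtain a where a: "homotopic_with_canon (\<lambda>x. True) C (-{0}) F (\<lambda>x. a)"
      using log[OF C] inessential_eq_continuous_logarithm[of C F]
      unfolding has_log_on_def by blast
    have "a \<noteq> 0"
      using homotopic_with_imp_subset2[OF a] in_components_nonempty[OF C] by auto
    have "path_connected (-{0::complex})"
      by (simp add: path_connected_punctured_universe)
    then have "path_component (-{0}) a (1::complex)"
      using \<open>a \<noteq> 0\<close> by (simp add: path_connected_component)
    then have "homotopic_with_canon (\<lambda>x. True) C (-{0}) (\<lambda>x. a) (\<lambda>x. 1)"
      using homotopic_constant_maps[of "top_of_set C" "top_of_set (-{0})" a 1] by simp
    then show ?thesis
      using a homotopic_with_trans by blast
  qed
  then have "homotopic_with_canon (\<lambda>x. True) S (-{0}) F (\<lambda>x. 1)"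
    using \<open>compact S\<close> F by (subst homotopic_on_components_eq[OF _ anr]) auto
  then show ?thesis
    using inessential_eq_continuous_logarithm[of S F] unfolding has_log_on_def by blast
qed

text \<open>
  On a finite set of values even the discontinuous principal logarithm is continuous.
\<close>

lemma has_log_on_finite_image:
  assumes "continuous_on S F" "finite (F ` S)" "\<And>x. x \<in> S \<Longrightarrow> F x \<noteq> 0"
  shows "has_log_on S F"
  unfolding has_log_on_def
proof (intro exI conjI)
  show "continuous_on S (\<lambda>x. Ln (F x))"
    using continuous_on_compose[OF assms(1) continuous_on_finite[OF assms(2), of Ln]]
    by (simp add: o_def)
qed (use assms(3) in auto)

text \<open>
  The replacements on the single regions agree with \<open>F\<close> on the frontiers and therefore glue.
  Finiteness keeps the union of the closed pieces closed.
\<close>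

lemma nonvanishing_on_finitely_many_regions:
  assumes "finite \<B>" and F: "continuous_on UNIV F"
    and "\<And>B. B \<in> \<B> \<Longrightarrow> open B \<and> frontier B \<inter> \<Union>\<B> = {} \<and> \<not> essential_region F B"
  shows "\<exists>F'. continuous_on UNIV F' \<and> (\<forall>x. x \<notin> \<Union>\<B> \<longrightarrow> F' x = F x) \<and> (\<forall>x \<in> \<Union>\<B>. F' x \<noteq> 0)"
  using assms(1,3)
proof (induction \<B>)
  case empty
  then show ?case using F by auto
next
  case (insert B \<B>)
  then obtain F' where F': "continuous_on UNIV F'" "\<And>x. x \<notin> \<Union>\<B> \<Longrightarrow> F' x = F x"
    "\<And>x. x \<in> \<Union>\<B> \<Longrightarrow> F' x \<noteq> 0"
    by (metis (no_types, lifting) Int_Un_distrib Union_insert insertCI sup_eq_bot_iff)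
  obtain h where h: "continuous_on (closure B) h" "\<And>x. x \<in> closure B \<Longrightarrow> h x \<noteq> 0"
    "\<And>x. x \<in> frontier B \<Longrightarrow> h x = F x"
    using insert.prems[of B] unfolding essential_region_def by blast
  have B: "open B" "frontier B \<inter> \<Union>(insert B \<B>) = {}"
    using insert.prems[of B] by auto
  have "continuous_on (closure B \<union> - B) (\<lambda>x. if x \<in> closure B then h x else F' x)"
  proof (rule continuous_on_cases)
    show "continuous_on (- B) F'"
      using F'(1) continuous_on_subset by blast
    show "\<forall>x. x \<in> closure B \<and> x \<notin> closure B \<or> x \<in> - B \<and> x \<in> closure B \<longrightarrow> h x = F' x"
      using h(3) F'(2) B frontier_def interior_open by fastforce
  qed (use h B in auto)
  moreover have "closure B \<union> - B = UNIV"
    using closure_subset by blast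
  ultimately have "continuous_on UNIV (\<lambda>x. if x \<in> closure B then h x else F' x)"
    by simp
  moreover have "(if x \<in> closure B then h x else F' x) = F x" if "x \<notin> \<Union>(insert B \<B>)" for x
    using that h(3) F'(2) B by (auto simp: frontier_def interior_open)
  moreover have "(if x \<in> closure B then h x else F' x) \<noteq> 0" if "x \<in> \<Union>(insert B \<B>)" for x
    using that h(2) F'(3) closure_subset[of B] by auto
  ultimately show ?case
    by blast
qed

text \<open>
  If all bounded complementary regions of \<open>C\<close> were inessential, \<open>F\<close> could be made nowhere vanishing on
  \<open>C\<close> with its holes filled. The complement of that compact set is connected, so it is Borsukian: the
  new map has a logarithm on it, and this restricts to a logarithm of \<open>F\<close> on \<open>C\<close>.
\<close>

lemma essential_complementary_region:
  assumes F: "continuous_on UNIV F" and C: "compact C"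
    and nz: "\<And>x. x \<in> C \<Longrightarrow> F x \<noteq> 0" and nolog: "\<not> has_log_on C F"
  shows "\<exists>B \<in> components (- C). bounded B \<and> essential_region F B"
proof (rule ccontr)
  assume "\<not> ?thesis"
  then have iness: "\<not> essential_region F B" if "B \<in> components (- C)" "bounded B" for B
    using that by blast
  define H where "H = C \<union> inside C"
  have H: "H = - outside C"
    unfolding H_def using inside_outside[of C] outside_no_overlap[of C] by blast
  have "closed C" "bounded C" using C by (auto simp: compact_imp_closed compact_imp_bounded)
  have "compact H"
    using H_def H \<open>closed C\<close> \<open>bounded C\<close>
    by (metis bounded_Un bounded_inside closed_Compl compact_eq_bounded_closed open_outside)
  \<comment> \<open>There may be infinitely many holes, but only those that contain a zero need a replacement, and by
    compactness these are finitely many.\<close>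
  define Z where "Z = {x \<in> H. F x = 0}"
  have "closed ({x. F x = 0})"
    using F by (intro closed_Collect_eq) auto
  then have "compact Z"
    unfolding Z_def using \<open>compact H\<close> by (metis Collect_conj_eq Collect_mem_eq compact_Int_closed)
  define \<B> where "\<B> = {B \<in> components (- C). bounded B}"
  have "Z \<subseteq> \<Union>\<B>"
  proof
    fix x assume "x \<in> Z"
    then have "x \<in> inside C" using nz unfolding Z_def H_def by auto
    then have "x \<in> - C" "bounded (connected_component_set (- C) x)"
      by (auto simp: inside_def)
    then show "x \<in> \<Union>\<B>"
      unfolding \<B>_def by (auto simp: components_def intro!: exI[of _ "connected_component_set (- C) x"])
  qed
  moreover have op: "open B" if "B \<in> \<B>" for B
    using that \<open>closed C\<close> unfolding \<B>_def by (auto intro: open_components)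
  ultimately obtain \<F> where \<F>: "finite \<F>" "\<F> \<subseteq> \<B>" "Z \<subseteq> \<Union>\<F>"
    using \<open>compact Z\<close> by (meson compactE)
  have "open B \<and> frontier B \<inter> \<Union>\<F> = {} \<and> \<not> essential_region F B" if "B \<in> \<F>" for B
  proof -
    have "frontier B \<subseteq> C"
      using that \<F> \<open>closed C\<close> unfolding \<B>_def by (auto dest: frontier_of_components_closed_complement)
    moreover have "\<Union>\<F> \<subseteq> - C"
      using \<F> in_components_subset unfolding \<B>_def by blast
    ultimately show ?thesis
      using iness op that \<F> unfolding \<B>_def by blast
  qed
  then obtain F' where F': "continuous_on UNIV F'" "\<And>x. x \<notin> \<Union>\<F> \<Longrightarrow> F' x = F x"
    "\<And>x. x \<in> \<Union>\<F> \<Longrightarrow> F' x \<noteq> 0"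
    using nonvanishing_on_finitely_many_regions[OF \<F>(1) F] by metis
  have nz': "F' x \<noteq> 0" if "x \<in> H" for x
    using that F'(2,3)[of x] \<F>(3) unfolding Z_def by (cases "x \<in> \<Union>\<F>") auto
  have "connected (- H)"
    unfolding H using \<open>bounded C\<close> by (simp add: connected_outside)
  then have "Borsukian H"
    using Borsukian_separation_compact[OF \<open>compact H\<close>] by simp
  then obtain l where l: "continuous_on H l" "\<And>x. x \<in> H \<Longrightarrow> F' x = exp (l x)"
    using F'(1) nz' continuous_on_subset unfolding Borsukian_continuous_logarithm
    by (metis (no_types, lifting) ComplI Pi_I' singletonD subset_UNIV)
  have "C \<inter> \<Union>\<F> = {}"
    using \<F> in_components_subset unfolding \<B>_def by blast
  then have "has_log_on C F"
    unfolding has_log_on_def using l F'(2) unfolding H_def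
    by (metis UnCI continuous_on_subset disjoint_iff sup_ge1)
  then show False using nolog by blast
qed

text \<open>
  Cut \<open>B\<close> along the level \<open>cmod (F x) = p\<close>, which consists of \<open>G\<close> and of a part \<open>G'\<close> without winding.
  If \<open>F\<close> had a logarithm on the part of \<open>G\<close> in \<open>B\<close>, it would have one on the whole level in \<open>B\<close>; by
  Tietze this logarithm would extend over the sublevel set, and \<open>B\<close> would be inessential. So some
  component of \<open>G\<close> in \<open>B\<close> carries winding, and one of the holes of that component is essential.
  Connectedness of \<open>- B\<close> keeps this hole inside \<open>B\<close>. The property passes on to the next region,
  because the holes of a connected set have connected complements.
\<close>

lemma essential_region_descent:
  fixes F :: "complex \<Rightarrow> complex"
  assumes F: "continuous_on UNIV F"
    and B: "open B" "bounded B" "connected (- B)" "essential_region F B"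
    and p: "p > 0" "\<And>x. x \<in> frontier B \<Longrightarrow> p < cmod (F x)"
    and G: "closed G" "closed G'" "G \<inter> G' = {}" "{x. cmod (F x) = p} = G \<union> G'"
    and fin: "finite (F ` G')"
  shows "\<exists>B'. open B' \<and> bounded B' \<and> connected (- B') \<and> essential_region F B' \<and>
              B' \<subseteq> B \<and> frontier B' \<subseteq> G \<inter> B"
proof -
  have level: "cmod (F x) = p" if "x \<in> G \<union> G'" for x
    using that G(4) by blast
  have nz: "F x \<noteq> 0" if "x \<in> G \<union> G'" for x
    using level[OF that] p(1) by auto
  have clB: "closure B = B \<union> frontier B"
    using closure_Un_frontier by blast
  define S where "S = G \<inter> closure B"
  have "compact S"
    unfolding S_def using G B by (simp add: closed_Int_compact)
  have SB: "S \<subseteq> G \<inter> B"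
    unfolding S_def clB using p(2) level by force
  have "\<exists>C \<in> components S. \<not> has_log_on C F"
  proof (rule ccontr)
    assume "\<not> ?thesis"
    then have "has_log_on S F"
      using has_log_on_componentwise[OF \<open>compact S\<close>, of F] nz F continuous_on_subset SB by blast
    then obtain l1 where l1: "continuous_on S l1" "\<And>x. x \<in> S \<Longrightarrow> F x = exp (l1 x)"
      unfolding has_log_on_def by blast
    have "has_log_on G' F"
      using F continuous_on_subset fin nz by (intro has_log_on_finite_image) auto
    then obtain l2 where l2: "continuous_on G' l2" "\<And>x. x \<in> G' \<Longrightarrow> F x = exp (l2 x)"
      unfolding has_log_on_def by blast
    have "closed S" using \<open>compact S\<close> by (simp add: compact_imp_closed)
    have "continuous_on (S \<union> G') (\<lambda>x. if x \<in> S then l1 x else l2 x)"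
      using \<open>closed S\<close> G l1 l2 SB by (intro continuous_on_cases) auto
    then obtain l where l: "continuous_on UNIV l"
        "\<And>x. x \<in> S \<union> G' \<Longrightarrow> l x = (if x \<in> S then l1 x else l2 x)"
    proof (rule Tietze_unbounded[of "S \<union> G'" "\<lambda>x. if x \<in> S then l1 x else l2 x" UNIV])
      show "closedin (top_of_set UNIV) (S \<union> G')"
        using \<open>closed S\<close> G(2) by auto
    qed auto
    have exp_l: "F x = exp (l x)" if "x \<in> S \<union> G'" for x
      using l(2)[OF that] l1(2) l2(2) that by auto
    \<comment> \<open>All zeros of \<open>F\<close> in \<open>B\<close> lie in the sublevel set \<open>V\<close>, and its frontier lies on the level.\<close>
    define V where "V = {x \<in> B. cmod (F x) < p}"
    have "open {x. cmod (F x) < p}"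
      using F by (intro open_Collect_less continuous_intros)
    then have "open V"
      unfolding V_def using B(1) by (metis Collect_conj_eq Collect_mem_eq open_Int)
    have "closed {x. cmod (F x) \<le> p}"
      using F by (intro closed_Collect_le continuous_intros)
    then have clV: "closure V \<subseteq> {x. cmod (F x) \<le> p}"
      unfolding V_def by (intro closure_minimal) auto
    moreover have "closure V \<subseteq> closure B"
      unfolding V_def by (intro closure_mono) auto
    ultimately have clVB: "closure V \<subseteq> B"
      using p(2) unfolding clB by fastforce
    have frV: "frontier V \<subseteq> S \<union> G'"
    proof
      fix x assume x: "x \<in> frontier V"
      then have "x \<in> closure V" "x \<notin> V"
        using \<open>open V\<close> by (auto simp: frontier_def interior_open)
      then have "x \<in> B" "cmod (F x) = p"
        using clV clVB unfolding V_def by fastforce+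
      then show "x \<in> S \<union> G'"
        using G(4) clB unfolding S_def by blast
    qed
    define h where "h = (\<lambda>x. if x \<in> closure V then exp (l x) else F x)"
    have "continuous_on (closure V \<union> - V) h"
      unfolding h_def
    proof (rule continuous_on_cases)
      show "continuous_on (closure V) (\<lambda>x. exp (l x))"
        using l(1) by (intro continuous_intros) (auto intro: continuous_on_subset)
      show "continuous_on (- V) F"
        using F continuous_on_subset by blast
      show "\<forall>x. x \<in> closure V \<and> x \<notin> closure V \<or> x \<in> - V \<and> x \<in> closure V \<longrightarrow> exp (l x) = F x"
        using exp_l frV \<open>open V\<close> by (auto simp: frontier_def interior_open)
    qed (use \<open>open V\<close> in auto)
    moreover have "closure V \<union> - V = UNIV"
      using closure_subset by blast
    ultimately have "continuous_on (closure B) h"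
      using continuous_on_subset by (metis subset_UNIV)
    moreover have "h x \<noteq> 0" if "x \<in> closure B" for x
    proof (cases "x \<in> closure V")
      case False
      then have "x \<notin> V" using closure_subset by blast
      then show ?thesis
        using that p False unfolding h_def V_def clB by fastforce
    qed (simp add: h_def)
    moreover have "h x = F x" if "x \<in> frontier B" for x
      using p(2)[OF that] clV unfolding h_def by fastforce
    ultimately show False
      using B(4) unfolding essential_region_def by blast
  qed
  then obtain C where C: "C \<in> components S" "\<not> has_log_on C F" by blast
  have "compact C"
    using C(1) \<open>compact S\<close> by (simp add: compact_components)
  have CS: "C \<subseteq> S" "connected C"
    using C in_components_subset in_components_connected by blast+
  then obtain B' where B': "B' \<in> components (- C)" "bounded B'" "essential_region F B'"
    using essential_complementary_region[OF F \<open>compact C\<close> _ C(2)] nz SB by blast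
  have "closed C" using \<open>compact C\<close> compact_imp_closed by blast
  \<comment> \<open>Otherwise the unbounded connected set \<open>- B\<close>, which misses \<open>C\<close>, would lie in the bounded
    hole \<open>B'\<close>.\<close>
  have "B' \<subseteq> B"
  proof (rule ccontr)
    assume "\<not> B' \<subseteq> B"
    then have "B' \<inter> - B \<noteq> {}" by blast
    moreover have "- B \<subseteq> - C" using CS SB by blast
    ultimately have "- B \<subseteq> B'"
      using components_maximal[OF B'(1) B(3)] by blast
    then have "bounded (- B)" using B'(2) bounded_subset by blast
    then show False
      using cobounded_imp_unbounded[of "- B"] B(2) by simp
  qed
  moreover have "frontier B' \<subseteq> C"
    using B'(1) \<open>closed C\<close> by (simp add: frontier_of_components_closed_complement)
  moreover have "connected (- B')"
    using component_complement_connected[OF CS(2) B'(1)] .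
  moreover have "open B'"
    using \<open>closed C\<close> B'(1) by (meson open_Compl open_components)
  ultimately show ?thesis
    using B' CS SB by blast
qed

text \<open>
  A point on one frontier has its whole \<open>\<delta>\<close>-ball inside the preceding region, hence inside all earlier
  regions, while points on earlier frontiers lie outside. Points chosen on the frontiers are thus
  at pairwise distance at least \<open>\<delta>\<close>, and such a sequence cannot stay in a bounded set.
\<close>

lemma no_uniformly_separated_nest:
  fixes B :: "nat \<Rightarrow> 'a::euclidean_space set"
  assumes B: "\<And>k. open (B k)" "\<And>k. bounded (B k)" "\<And>k. B k \<noteq> {}"
    and nest: "\<And>k. B (Suc k) \<subseteq> B k" "\<And>k. frontier (B (Suc k)) \<subseteq> B k"
    and "\<delta> > 0"
    and sep: "\<And>k x y. x \<in> frontier (B k) \<Longrightarrow> y \<in> frontier (B (Suc k)) \<Longrightarrow> \<delta> \<le> dist x y"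
  shows False
proof -
  have "frontier (B k) \<noteq> {}" for k
    using B[of k] frontier_eq_empty not_bounded_UNIV by metis
  then obtain x where x: "\<And>k. x k \<in> frontier (B k)"
    using choice[of "\<lambda>k y. y \<in> frontier (B k)"] by blast
  have bl: "ball (x (Suc k)) \<delta> \<subseteq> B k" for k
  proof -
    have "x (Suc k) \<in> ball (x (Suc k)) \<delta> \<inter> B k"
      using x[of "Suc k"] nest(2)[of k] \<open>\<delta> > 0\<close> by auto
    moreover have "ball (x (Suc k)) \<delta> \<inter> frontier (B k) = {}"
      using sep[of _ k "x (Suc k)"] x by (force simp: dist_commute)
    ultimately show ?thesis
      using connected_Int_frontier[of "ball (x (Suc k)) \<delta>" "B k"] connected_ball by blast
  qed
  have mono: "B n \<subseteq> B m" if "m \<le> n" for m n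
    using lift_Suc_antimono_le[of B, OF nest(1) that] .
  have far: "\<delta> \<le> dist (x n) (x m)" if "m < n" for m n
  proof -
    obtain j where j: "n = Suc j" "m \<le> j" using \<open>m < n\<close> by (cases n) auto
    have "ball (x n) \<delta> \<subseteq> B m" using bl[of j] mono[OF j(2)] j by blast
    moreover have "x m \<notin> B m" using x[of m] B(1)[of m] by (simp add: frontier_def interior_open)
    ultimately show ?thesis by (meson in_mono mem_ball not_le)
  qed
  have "x n \<in> closure (B 0)" for n
    using x[of n] mono[of 0 n] closure_mono[of "B n" "B 0"] unfolding frontier_def by blast
  moreover have "compact (closure (B 0))" using B by simp
  ultimately obtain r l where r: "strict_mono r" "(x \<circ> r) \<longlonglongrightarrow> l"
    unfolding compact_def by blast
  then have "Cauchy (x \<circ> r)" using LIMSEQ_imp_Cauchy by blast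
  then obtain N where "\<And>m n. N \<le> m \<Longrightarrow> N \<le> n \<Longrightarrow> dist ((x \<circ> r) m) ((x \<circ> r) n) < \<delta>"
    using metric_CauchyD[OF _ \<open>\<delta> > 0\<close>] by blast
  then have "dist (x (r (Suc N))) (x (r N)) < \<delta>" by simp
  then show False using far[of "r N" "r (Suc N)"] r(1) by (simp add: strict_mono_Suc_iff)
qed

section \<open>The outer circle is essential in the space\<close>

lemma cyl_nth: "cyl r \<phi> z $ 1 = r * cos \<phi>" "cyl r \<phi> z $ 2 = r * sin \<phi>" "cyl r \<phi> z $ 3 = z"
  unfolding cyl_def by (simp_all add: vector_3)

definition horizontal_part :: "real ^ 3 \<Rightarrow> complex" where
  "horizontal_part a = Complex (a $ 1) (a $ 2)"

lemma horizontal_part_cyl: "horizontal_part (cyl r \<phi> z) = of_real r * cis \<phi>"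
  by (simp add: horizontal_part_def cyl_nth complex_eq_iff)

lemma continuous_on_horizontal_part: "continuous_on S horizontal_part"
  unfolding horizontal_part_def Complex_eq by (intro continuous_intros)

text \<open>
  Away from the surface, a point at distance \<open>p > 0\<close> from the axis lies on a connecting arc of length at
  least \<open>p\<close>. As the lengths tend to \<open>0\<close>, there are finitely many such arcs, each with one point at that
  distance.
\<close>

lemma finite_exceptional_points:
  assumes "arc_data r0 \<rho> \<phi>" "p > 0"
  shows "finite {a \<in> space_A r0 \<rho> \<phi>. cmod (horizontal_part a) = p \<and> a $ 3 \<noteq> sin (1 / p)}"
proof -
  have "eventually (\<lambda>n. \<rho> n < p) sequentially"
    using assms order_tendstoD(2) unfolding arc_data_def by blast
  then obtain N where N: "\<And>n. n \<ge> N \<Longrightarrow> \<rho> n < p"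
    unfolding eventually_sequentially by blast
  have "{a \<in> space_A r0 \<rho> \<phi>. cmod (horizontal_part a) = p \<and> a $ 3 \<noteq> sin (1 / p)} \<subseteq>
        (\<lambda>n. cyl p (\<phi> n) (sin (1 / \<rho> n))) ` {..<N}"
  proof
    fix a assume "a \<in> {a \<in> space_A r0 \<rho> \<phi>. cmod (horizontal_part a) = p \<and> a $ 3 \<noteq> sin (1 / p)}"
    then have a: "a \<in> space_A r0 \<rho> \<phi>" "cmod (horizontal_part a) = p" "a $ 3 \<noteq> sin (1 / p)" by auto
    consider "a \<in> sine_surface r0" | "a \<in> limit_arc"
      | n where "n \<ge> 1" "a \<in> connecting_arc (\<rho> n) (\<phi> n)"
      using a(1) unfolding space_A_def by auto
    then show "a \<in> (\<lambda>n. cyl p (\<phi> n) (sin (1 / \<rho> n))) ` {..<N}"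
    proof cases
      case 1
      then show ?thesis
        using a unfolding sine_surface_def by (auto simp: horizontal_part_cyl norm_mult cyl_nth)
    next
      case 2
      then show ?thesis
        using a \<open>p > 0\<close> unfolding limit_arc_def by (auto simp: horizontal_part_cyl)
    next
      case 3
      then obtain r where r: "a = cyl r (\<phi> n) (sin (1 / \<rho> n))" "0 \<le> r" "r \<le> \<rho> n"
        unfolding connecting_arc_def by auto
      then have "r = p" using a(2) by (simp add: horizontal_part_cyl norm_mult)
      then have "n < N" using r N[of n] by (meson not_le)
      then show ?thesis using r \<open>r = p\<close> by blast
    qed
  qed
  then show ?thesis
    by (rule finite_subset) simp
qed

definition surface_circle :: "real \<Rightarrow> complex \<Rightarrow> real ^ 3" where
  "surface_circle r t = vector [r * Re t, r * Im t, sin (1 / r)]"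

lemma surface_circle_eq_cyl:
  assumes "cmod t = 1"
  shows "surface_circle r t = cyl r (Arg t) (sin (1 / r))"
proof -
  have "t = cis (Arg t)"
    using assms by (metis cis_Arg mult_1 norm_zero of_real_1 rcis_cmod_Arg rcis_def zero_neq_one)
  then have "Re t = cos (Arg t)" "Im t = sin (Arg t)" by (metis cis.simps)+
  then show ?thesis by (simp add: surface_circle_def cyl_def)
qed

lemma surface_circle_in_surface:
  assumes "cmod t = 1" "0 < r" "r \<le> r0"
  shows "surface_circle r t \<in> sine_surface r0"
  unfolding sine_surface_def surface_circle_eq_cyl[OF assms(1)] using assms by blast

lemma horizontal_part_surface_circle: "horizontal_part (surface_circle r t) = of_real r * t"
  by (simp add: horizontal_part_def surface_circle_def complex_eq_iff vector_3)

text \<open>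
  A nowhere vanishing replacement, divided by its absolute value, would retract the disc onto its
  boundary circle.
\<close>

lemma essential_ball:
  fixes F :: "complex \<Rightarrow> complex"
  assumes "r > 0" "\<And>t. cmod t = 1 \<Longrightarrow> F t = of_real r * t"
  shows "essential_region F (ball 0 1)"
  unfolding essential_region_def
proof
  assume "\<exists>h. continuous_on (closure (ball 0 1)) h \<and> (\<forall>x\<in>closure (ball 0 1). h x \<noteq> 0) \<and>
    (\<forall>x\<in>frontier (ball 0 1). h x = F x)"
  then obtain h where h: "continuous_on (cball 0 1) h" "\<And>x. x \<in> cball 0 1 \<Longrightarrow> h x \<noteq> 0"
    "\<And>x. x \<in> sphere 0 1 \<Longrightarrow> h x = F x"
    by (auto simp: frontier_ball)
  have "continuous_on (cball 0 1) (\<lambda>x. h x / of_real (cmod (h x)))"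
    using h by (intro continuous_intros) auto
  moreover have "(\<lambda>x. h x / of_real (cmod (h x))) \<in> cball 0 1 \<rightarrow> sphere 0 1"
    using h(2) by (auto simp: norm_divide)
  moreover have "h x / of_real (cmod (h x)) = x" if "x \<in> sphere 0 1" for x
    using assms h(3)[OF that] that by (simp add: norm_mult)
  ultimately have "sphere 0 1 retract_of (cball (0::complex) 1)"
    unfolding retract_of_def retraction_def by (intro exI[of _ "\<lambda>x. h x / of_real (cmod (h x))"]) auto
  then show False
    using no_retraction_cball[of 1 "0::complex"] by simp
qed

text \<open>
  Essential regions are nested at the radii \<open>p k\<close>. There \<open>1 / p k\<close> is \<open>pi / 2\<close> plus a multiple of \<open>pi\<close>,
  so that the surface has heights \<open>1\<close> and \<open>-1\<close> in turn.
\<close>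

lemma outer_circle_not_nulhomotopic:
  assumes "r0 > 0" and A: "arc_data r0 \<rho> \<phi>"
  shows "\<not> nulhomotopic_in (top_of_set (space_A r0 \<rho> \<phi>)) (surface_circle r0)"
proof
  let ?A = "space_A r0 \<rho> \<phi>"
  assume "nulhomotopic_in (top_of_set ?A) (surface_circle r0)"
  then obtain g where g: "continuous_on (cball 0 1) g" "g ` cball 0 1 \<subseteq> ?A"
      "\<And>t. t \<in> sphere 0 1 \<Longrightarrow> g t = surface_circle r0 t"
    unfolding nulhomotopic_in_def by (auto simp: image_subset_iff_funcset)
  \<comment> \<open>The map is extended to the whole plane by the nearest point projection onto the disc, so that
    preimages of closed sets are closed in the plane.\<close>
  define g' where "g' = g \<circ> closest_point (cball 0 1)"
  have cp: "closest_point (cball 0 1) x \<in> cball 0 1" for x :: complex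
    by (rule closest_point_in_set) auto
  have g'A: "g' x \<in> ?A" for x
    unfolding g'_def using g(2) cp by fastforce
  have "continuous_on UNIV (closest_point (cball 0 1 :: complex set))"
    by (rule continuous_on_closest_point) auto
  then have g'c: "continuous_on UNIV g'"
    unfolding g'_def using g(1) cp by (intro continuous_on_compose) (auto intro: continuous_on_subset)
  have g'_surface_circle: "g' t = surface_circle r0 t" if "cmod t = 1" for t
    unfolding g'_def using g(3)[of t] that by (simp add: closest_point_self)
  define F where "F = horizontal_part \<circ> g'"
  define z where "z x = g' x $ 3" for x
  have F: "continuous_on UNIV F"
    unfolding F_def using g'c by (intro continuous_on_compose continuous_on_horizontal_part)
  have F_surface_circle: "F t = of_real r0 * t" if "cmod t = 1" for t
    unfolding F_def using g'_surface_circle[OF that] by (simp add: horizontal_part_surface_circle)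
  have zc: "continuous_on UNIV z"
    unfolding z_def using g'c by (intro continuous_intros)
  \<comment> \<open>The offset \<open>K\<close> makes the first radius smaller than \<open>r0\<close>.\<close>
  define K :: nat where "K = nat \<lceil>1 / r0\<rceil>"
  define a where "a k = pi / 2 + real (k + K) * pi" for k
  define p where "p k = 1 / a k" for k
  have apos: "a k > 0" for k
    unfolding a_def by (simp add: add_pos_nonneg)
  have ppos: "p k > 0" for k
    unfolding p_def using apos by simp
  have "a k < a (Suc k)" for k
    unfolding a_def by (simp add: distrib_right)
  then have p_dec: "p (Suc k) < p k" for k
    unfolding p_def using apos by (intro divide_strict_left_mono mult_pos_pos) auto
  have p0: "p 0 < r0"
  proof -
    have "1 / r0 \<le> real K"
      unfolding K_def by linarith
    also have "\<dots> \<le> real K * pi"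
      using pi_gt3 by (simp add: mult_le_cancel_left1)
    also have "\<dots> < a 0"
      unfolding a_def by simp
    finally show ?thesis
      unfolding p_def using \<open>r0 > 0\<close> apos[of 0] by (simp add: field_simps)
  qed
  have sin_p: "sin (1 / p k) = (-1) ^ (k + K)" for k
    unfolding p_def a_def by (simp add: sin_add del: of_nat_add)
  define G where "G k = {x. cmod (F x) = p k \<and> z x = sin (1 / p k)}" for k
  define E where "E k = {a \<in> ?A. cmod (horizontal_part a) = p k \<and> a $ 3 \<noteq> sin (1 / p k)}" for k
  define G' where "G' k = g' -` E k" for k
  have finE: "finite (E k)" for k
    unfolding E_def using finite_exceptional_points[OF A ppos] .
  have clG: "closed (G k)" for k
    unfolding G_def by (intro closed_Collect_conj closed_Collect_eq continuous_intros F zc)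
  have clG': "closed (G' k)" for k
    unfolding G'_def using closed_vimage[OF finite_imp_closed[OF finE] g'c] .
  have lev: "{x. cmod (F x) = p k} = G k \<union> G' k" "G k \<inter> G' k = {}" for k
    unfolding G_def G'_def E_def F_def z_def using g'A by auto
  have finG': "finite (F ` G' k)" for k
  proof -
    have "F ` G' k \<subseteq> horizontal_part ` E k"
      unfolding F_def G'_def by auto
    then show ?thesis using finE finite_subset by blast
  qed
  define P where "P k B \<longleftrightarrow> open B \<and> bounded B \<and> connected (- B) \<and> essential_region F B \<and> frontier B \<subseteq> G k"
    for k B
  have "\<exists>B. \<forall>n. P n (B n) \<and> (B (Suc n) \<subseteq> B n \<and> frontier (B (Suc n)) \<subseteq> B n)"
  proof (rule dependent_nat_choice)
    have "essential_region F (ball 0 1)"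
      using essential_ball[OF \<open>r0 > 0\<close> F_surface_circle] .
    moreover have "connected (- ball (0::complex) 1)"
      by (rule connected_complement_bounded_convex) auto
    moreover have "p 0 < cmod (F x)" if "x \<in> frontier (ball 0 1)" for x
      using that F_surface_circle[of x] p0 \<open>r0 > 0\<close> by (simp add: frontier_ball norm_mult)
    ultimately have "\<exists>B'. open B' \<and> bounded B' \<and> connected (- B') \<and> essential_region F B' \<and>
        B' \<subseteq> ball 0 1 \<and> frontier B' \<subseteq> G 0 \<inter> ball 0 1"
      using F ppos clG clG' lev finG' by (intro essential_region_descent[where p = "p 0" and G' = "G' 0"]) auto
    then show "\<exists>B. P 0 B"
      unfolding P_def by blast
  next
    fix B n assume "P n B"
    then have B: "open B" "bounded B" "connected (- B)" "essential_region F B" "frontier B \<subseteq> G n"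
      unfolding P_def by auto
    have "p (Suc n) < cmod (F x)" if "x \<in> frontier B" for x
      using that B(5) p_dec[of n] unfolding G_def by auto
    then have "\<exists>B'. open B' \<and> bounded B' \<and> connected (- B') \<and> essential_region F B' \<and>
        B' \<subseteq> B \<and> frontier B' \<subseteq> G (Suc n) \<inter> B"
      using F B ppos clG clG' lev finG'
      by (intro essential_region_descent[where p = "p (Suc n)" and G' = "G' (Suc n)"]) auto
    then show "\<exists>B'. P (Suc n) B' \<and> B' \<subseteq> B \<and> frontier B' \<subseteq> B"
      unfolding P_def by blast
  qed
  then obtain B where B: "\<And>n. P n (B n)" "\<And>n. B (Suc n) \<subseteq> B n" "\<And>n. frontier (B (Suc n)) \<subseteq> B n"
    by blast
  \<comment> \<open>Heights on consecutive frontiers differ by \<open>2\<close>, so uniform continuity keeps the frontiers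
    apart.\<close>
  have "uniformly_continuous_on (closure (B 0)) z"
    using zc B(1)[of 0] continuous_on_subset unfolding P_def
    by (intro compact_uniformly_continuous) auto
  then obtain \<delta> where \<delta>: "\<delta> > 0"
      "\<And>x y. x \<in> closure (B 0) \<Longrightarrow> y \<in> closure (B 0) \<Longrightarrow> dist y x < \<delta> \<Longrightarrow> dist (z y) (z x) < 2"
    unfolding uniformly_continuous_on_def by (metis zero_less_numeral)
  have cl: "frontier (B n) \<subseteq> closure (B 0)" for n
    using lift_Suc_antimono_le[of B, OF B(2), of 0 n] closure_mono[of "B n" "B 0"] unfolding frontier_def by blast
  show False
  proof (rule no_uniformly_separated_nest[of B \<delta>])
    show "B k \<noteq> {}" for k
      using B(1)[of k] unfolding P_def essential_region_def by auto
    show "\<delta> \<le> dist x y" if "x \<in> frontier (B k)" "y \<in> frontier (B (Suc k))" for k x y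
    proof (rule ccontr)
      assume "\<not> \<delta> \<le> dist x y"
      then have "dist (z x) (z y) < 2"
        using \<delta>(2)[of y x] cl that by (meson not_le subsetD)
      moreover have "z x = (-1) ^ (k + K)" "z y = (-1) ^ (Suc k + K)"
        using that B(1)[of k] B(1)[of "Suc k"] unfolding P_def G_def sin_p by auto
      ultimately show False
        by (cases "even (k + K)") (auto simp: dist_norm)
    qed
  qed (use B \<delta>(1) in \<open>auto simp: P_def\<close>)
qed

section \<open>Absolute retracts are contractible relative to a point\<close>

text \<open>
  With a metric \<open>d\<close> bounded by \<open>1\<close>, the space \<open>R\<close> is isometric, by \<open>x \<mapsto> d x\<close>, to a set of bounded
  functions with the supremum distance (Kuratowski's embedding). All segments from the function of \<open>q\<close>
  to the other functions \<open>d x\<close> form a star-shaped metrizable space \<open>C\<close>. It contains the copy of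
  \<open>R\<close> as a closed subset (an argument of Wojdyslawski), hence retracts onto it. The retraction carries
  the contraction of \<open>C\<close> along the segments to a contraction of \<open>R\<close>.
\<close>

lemma absolute_retract_contracts_to_point:
  fixes R :: "'b topology"
  assumes R: "absolute_retract R" and q: "q \<in> topspace R"
  shows "\<exists>H. continuous_map (prod_topology R (top_of_set {0..1::real})) R H \<and>
             (\<forall>x \<in> topspace R. H (x, 0) = q \<and> H (x, 1) = x) \<and> (\<forall>s \<in> {0..1}. H (q, s) = q)"
proof -
  have "metrizable_space R" using R unfolding absolute_retract_def by blast
  then obtain M d0 where "Metric_space M d0" and R0: "R = Metric_space.mtopology M d0"
    unfolding metrizable_space_def by blast
  interpret D: Metric_space M d0 by fact
  define d where "d = D.capped_dist 1"
  interpret Metric_space M d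
    unfolding d_def by (rule D.capped_dist)
  have R_eq: "R = mtopology"
    unfolding d_def R0 by (simp add: D.mtopology_capped_metric)
  have d_le: "d x y \<le> 1" for x y
    unfolding d_def D.capped_dist_def by simp
  have qM: "q \<in> M" using q R_eq by simp
  define E where "E = (Met_TC.fspace M :: ('b \<Rightarrow> real) set)"
  define \<Delta> where "\<Delta> = (Met_TC.fdist M :: ('b \<Rightarrow> real) \<Rightarrow> ('b \<Rightarrow> real) \<Rightarrow> real)"
  interpret E: Metric_space E \<Delta>
    unfolding E_def \<Delta>_def by (rule Met_TC.Metric_space_funspace)
  have \<Delta>_le: "\<Delta> f g \<le> a \<longleftrightarrow> (\<forall>y \<in> M. \<bar>f y - g y\<bar> \<le> a)" if "f \<in> E" "g \<in> E" for f g a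
    using that qM Met_TC.funspace_mdist_le[of f M g a] unfolding E_def \<Delta>_def dist_real_def by auto
  \<comment> \<open>\<open>J (x, s)\<close> is the point with parameter \<open>s\<close> on the segment from the function of \<open>q\<close> to that
    of \<open>x\<close>.\<close>
  define J where "J = (\<lambda>(x, s::real). restrict (\<lambda>y. (1 - s) * d q y + s * d x y) M)"
  have J_E: "J (x, s) \<in> E" if "x \<in> M" "s \<in> {0..1}" for x s
  proof -
    have "\<bar>(1 - s) * d q y + s * d x y\<bar> \<le> 1" if "y \<in> M" for y
    proof -
      have "(1 - s) * d q y + s * d x y \<le> (1 - s) * 1 + s * 1"
        using d_le \<open>s \<in> {0..1}\<close> by (intro add_mono mult_left_mono) auto
      moreover have "0 \<le> (1 - s) * d q y + s * d x y"
        using \<open>s \<in> {0..1}\<close> by auto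
      ultimately show ?thesis by simp
    qed
    then have "bounded (J (x, s) ` M)"
      unfolding bounded_iff J_def by auto
    then show ?thesis
      unfolding E_def Met_TC.fspace_def J_def by auto
  qed
  have J_dist: "\<Delta> (J (x, s)) (J (x', s')) \<le> \<bar>s - s'\<bar> + d x x'"
    if "x \<in> M" "x' \<in> M" "s \<in> {0..1}" "s' \<in> {0..1}" for x x' s s'
  proof -
    have "\<bar>((1 - s) * d q y + s * d x y) - ((1 - s') * d q y + s' * d x' y)\<bar> \<le> \<bar>s - s'\<bar> + d x x'"
      if "y \<in> M" for y
    proof -
      have "((1 - s) * d q y + s * d x y) - ((1 - s') * d q y + s' * d x' y) =
            (s - s') * (d x y - d q y) + s' * (d x y - d x' y)"
        by (simp add: algebra_simps)
      moreover have "\<bar>(s - s') * (d x y - d q y)\<bar> \<le> \<bar>s - s'\<bar>"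
      proof -
        have "\<bar>d x y - d q y\<bar> \<le> 1"
          using d_le[of x y] d_le[of q y] nonneg[of x y] nonneg[of q y] by linarith
        then show ?thesis
          by (simp add: abs_mult mult_left_le)
      qed
      moreover have "\<bar>s' * (d x y - d x' y)\<bar> \<le> d x x'"
      proof -
        have "\<bar>d x y - d x' y\<bar> \<le> d x x'"
          using triangle[of x x' y] triangle[of x' x y] commute[of x x'] \<open>x \<in> M\<close> \<open>x' \<in> M\<close> that by linarith
        then have "\<bar>s'\<bar> * \<bar>d x y - d x' y\<bar> \<le> 1 * d x x'"
          using \<open>s' \<in> {0..1}\<close> by (intro mult_mono) auto
        then show ?thesis by (simp add: abs_mult)
      qed
      ultimately show ?thesis by linarith
    qed
    then show ?thesis
      unfolding \<Delta>_le[OF J_E[OF that(1,3)] J_E[OF that(2,4)]] by (simp add: J_def)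
  qed
  define I where "I = top_of_set {0..1::real}"
  have J_cont: "continuous_map (prod_topology R I) E.mtopology J"
    unfolding E.continuous_map_to_metric
  proof (intro ballI allI impI)
    fix xs :: "'b \<times> real" and \<epsilon> :: real assume xs: "xs \<in> topspace (prod_topology R I)" and "\<epsilon> > 0"
    obtain x s where xs_eq: "xs = (x, s)" by fastforce
    have x: "x \<in> M" "s \<in> {0..1}" using xs R_eq xs_eq unfolding I_def by auto
    define U where "U = mball x (\<epsilon> / 2) \<times> ({0..1} \<inter> ball s (\<epsilon> / 2))"
    have "openin (prod_topology R I) U"
      unfolding U_def openin_prod_Times_iff I_def R_eq by (auto simp: openin_open_Int)
    moreover have "xs \<in> U"
      unfolding U_def xs_eq using x \<open>\<epsilon> > 0\<close> by auto
    moreover have "J w \<in> E.mball (J xs) \<epsilon>" if "w \<in> U" for w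
    proof -
      obtain x' s' where w: "w = (x', s')" by fastforce
      have x': "x' \<in> M" "s' \<in> {0..1}" "d x x' < \<epsilon> / 2" "\<bar>s - s'\<bar> < \<epsilon> / 2"
        using that unfolding U_def w by (auto simp: dist_real_def)
      have "\<Delta> (J xs) (J w) < \<epsilon>"
        using J_dist[of x x' s s'] x x' unfolding xs_eq w by linarith
      then show ?thesis
        using x x' J_E unfolding xs_eq w by simp
    qed
    ultimately show "\<exists>U. openin (prod_topology R I) U \<and> xs \<in> U \<and> (\<forall>y\<in>U. J y \<in> E.mball (J xs) \<epsilon>)"
      by blast
  qed
  define \<iota> where "\<iota> x = J (x, 1)" for x
  have \<iota>_apply: "\<iota> x y = d x y" if "y \<in> M" for x y
    using that unfolding \<iota>_def J_def by simp
  have \<iota>_E: "\<iota> x \<in> E" if "x \<in> M" for x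
    unfolding \<iota>_def using J_E that by simp
  have isom: "\<Delta> (\<iota> x) (\<iota> x') = d x x'" if "x \<in> M" "x' \<in> M" for x x'
  proof (rule antisym)
    show "\<Delta> (\<iota> x) (\<iota> x') \<le> d x x'"
      unfolding \<iota>_def using J_dist[of x x' 1 1] that by simp
    have "\<bar>\<iota> x x' - \<iota> x' x'\<bar> \<le> \<Delta> (\<iota> x) (\<iota> x')"
      using \<Delta>_le[OF \<iota>_E \<iota>_E, of x x' "\<Delta> (\<iota> x) (\<iota> x')"] that by blast
    then show "d x x' \<le> \<Delta> (\<iota> x) (\<iota> x')"
      using that by (simp add: \<iota>_apply)
  qed
  define C where "C = J ` (M \<times> {0..1})"
  define Y where "Y = subtopology E.mtopology C"
  have CE: "C \<subseteq> E" unfolding C_def using J_E by auto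
  then have topY: "topspace Y = C" unfolding Y_def by auto
  have metY: "metrizable_space Y"
    unfolding Y_def by (intro metrizable_space_subtopology E.metrizable_space_mtopology)
  interpret ME: Metric_space12 M d E \<Delta> ..
  have "embedding_map R E.mtopology \<iota>"
    unfolding R_eq using \<iota>_E isom by (intro ME.isometry_imp_embedding_map) auto
  moreover have \<iota>C: "\<iota> ` M \<subseteq> C" unfolding \<iota>_def C_def by auto
  ultimately have emb: "embedding_map R Y \<iota>"
    unfolding Y_def embedding_map_in_subtopology by (simp add: R_eq)
  have clo: "closedin Y (\<iota> ` topspace R)"
  proof -
    have "\<exists>r>0. \<forall>x' \<in> M. r \<le> \<Delta> f (\<iota> x')" if f: "f \<in> C" "f \<notin> \<iota> ` M" for f
    proof -
      obtain x s where xs: "f = J (x, s)" "x \<in> M" "s \<in> {0..1}"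
        using f(1) unfolding C_def by auto
      have f_apply: "f y = (1 - s) * d q y + s * d x y" if "y \<in> M" for y
        using that unfolding xs J_def by simp
      have fE: "f \<in> E" using f CE by auto
      have s: "s \<noteq> 1" using f(2) xs \<iota>_def by auto
      have s0: "s \<noteq> 0"
      proof
        assume "s = 0"
        then have "f = \<iota> q" unfolding xs \<iota>_def J_def by auto
        then show False using f(2) qM by auto
      qed
      have "x \<noteq> q"
      proof
        assume "x = q"
        then have "f = \<iota> q" unfolding xs \<iota>_def J_def by (auto simp: algebra_simps)
        then show False using f(2) qM by auto
      qed
      then have dqx: "d q x > 0" using qM xs by (metis mdist_pos_eq)
      \<comment> \<open>A function \<open>d x'\<close> vanishes at \<open>x'\<close>. The value of \<open>f\<close> there is a proper convex combination of the
        distances of \<open>x'\<close> to \<open>q\<close> and to \<open>x\<close>, which are not both small.\<close>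
      define m where "m = min s (1 - s)"
      have m: "m > 0" "m \<le> s" "m \<le> 1 - s" using s s0 xs(3) unfolding m_def by auto
      have "m * d q x \<le> \<Delta> f (\<iota> x')" if x': "x' \<in> M" for x'
      proof -
        have "m * d q x \<le> m * (d q x' + d x x')"
          using triangle[of q x' x] commute[of x x'] m qM xs x' by (intro mult_left_mono) auto
        also have "\<dots> \<le> (1 - s) * d q x' + s * d x x'"
          unfolding distrib_left using m by (intro add_mono mult_right_mono) auto
        also have "\<dots> \<le> \<bar>f x' - \<iota> x' x'\<bar>"
          using f_apply[OF x'] \<iota>_apply[OF x'] x' by simp
        also have "\<dots> \<le> \<Delta> f (\<iota> x')"
          using \<Delta>_le[OF fE \<iota>_E, of x' "\<Delta> f (\<iota> x')"] x' by blast
        finally show ?thesis .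
      qed
      then show ?thesis using m dqx by (intro exI[of _ "m * d q x"]) auto
    qed
    note far = this
    have "openin Y (C - \<iota> ` M)"
      unfolding openin_subopen[of Y "C - \<iota> ` M"]
    proof
      fix f assume f: "f \<in> C - \<iota> ` M"
      then obtain r where r: "r > 0" "\<And>x'. x' \<in> M \<Longrightarrow> r \<le> \<Delta> f (\<iota> x')" using far by blast
      have "openin Y (C \<inter> E.mball f r)"
        unfolding Y_def by (simp add: openin_subtopology_Int2)
      moreover have "f \<in> C \<inter> E.mball f r" using f CE r by auto
      moreover have "C \<inter> E.mball f r \<subseteq> C - \<iota> ` M" using r(2) by force
      ultimately show "\<exists>T. openin Y T \<and> f \<in> T \<and> T \<subseteq> C - \<iota> ` M" by blast
    qed
    then show ?thesis
      unfolding closedin_def topY using \<iota>C R_eq by simp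
  qed
  have "\<iota> ` topspace R retract_of_space Y"
    using R metY emb clo unfolding absolute_retract_def by blast
  then obtain ret where ret: "continuous_map Y (subtopology Y (\<iota> ` M)) ret"
      "\<And>f. f \<in> \<iota> ` M \<Longrightarrow> ret f = f"
    unfolding retract_of_space_def using R_eq by auto
  have "homeomorphic_map R (subtopology Y (\<iota> ` M)) \<iota>"
    using emb unfolding embedding_map_def by (simp add: R_eq)
  then obtain j where j: "continuous_map (subtopology Y (\<iota> ` M)) R j" "\<And>x. x \<in> M \<Longrightarrow> j (\<iota> x) = x"
    unfolding homeomorphic_map_maps homeomorphic_maps_def using R_eq by auto
  define H where "H = j \<circ> ret \<circ> J"
  have "continuous_map (prod_topology R I) Y J"
    unfolding Y_def using J_cont by (rule continuous_map_into_subtopology) (auto simp: C_def I_def R_eq)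
  then have "continuous_map (prod_topology R I) R H"
    unfolding H_def using ret(1) j(1) by (intro continuous_map_compose)
  moreover have "H (x, 0) = q \<and> H (x, 1) = x" if "x \<in> topspace R" for x
  proof -
    have "J (x, 0) = \<iota> q" "J (x, 1) = \<iota> x" unfolding \<iota>_def J_def by auto
    then show ?thesis
      unfolding H_def using that ret(2) j(2) qM R_eq by simp
  qed
  moreover have "H (q, s) = q" for s
  proof -
    have "J (q, s) = \<iota> q" unfolding \<iota>_def J_def by (auto simp: algebra_simps)
    then show ?thesis
      unfolding H_def using ret(2) j(2) qM by simp
  qed
  ultimately show ?thesis unfolding I_def by blast
qed

section \<open>The outer circle is inessential in all neighbourhoods\<close>

lemma surface_circle_in_space:
  assumes "cmod t = 1" "0 < r" "r \<le> r0"
  shows "surface_circle r t \<in> space_A r0 \<rho> \<phi>"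
  using surface_circle_in_surface[OF assms] unfolding space_A_def by auto

lemma continuous_on_surface_circle:
  fixes S :: "'a::t2_space set"
  assumes "continuous_on S r" "continuous_on S f" "\<And>t. t \<in> S \<Longrightarrow> r t \<noteq> 0"
  shows "continuous_on S (\<lambda>t. surface_circle (r t) (f t))"
proof -
  have "surface_circle s w =
      (s * Re w) *\<^sub>R axis 1 1 + (s * Im w) *\<^sub>R axis 2 1 + sin (1 / s) *\<^sub>R axis 3 1" for s w
    by (simp add: surface_circle_def vec_eq_iff forall_3 vector_3 axis_def)
  then show ?thesis
    using assms by (auto intro!: continuous_intros)
qed

text \<open>
  On the disc, the filling follows the circles of the surface from radius \<open>r0\<close> at the boundary to a
  small radius \<open>r1\<close> at absolute value \<open>1/2\<close>, contracts the small circle in \<open>R\<close> between \<open>1/2\<close> and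
  \<open>1/4\<close>, and stays at the limit point within \<open>1/4\<close>. The contraction keeps the base point fixed, so
  by the tube lemma it moves all points near the base point within the given neighbourhood.
\<close>

lemma outer_circle_nulhomotopic_near:
  fixes R :: "'b topology"
  assumes "r0 > 0" and R: "absolute_retract R"
    and e: "continuous_map (top_of_set (space_A r0 \<rho> \<phi>)) R e"
    and V: "neighbourhood_in_space R (e ` space_A r0 \<rho> \<phi>) V"
  shows "nulhomotopic_in (subtopology R V) (e \<circ> surface_circle r0)"
proof -
  let ?A = "space_A r0 \<rho> \<phi>"
  obtain U where U: "openin R U" "e ` ?A \<subseteq> U" "U \<subseteq> V"
    using V unfolding neighbourhood_in_space_def by blast
  have oA: "0 \<in> ?A"
  proof -
    have "(0 :: real ^ 3) = cyl 0 0 0"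
      unfolding cyl_def by (simp add: vec_eq_iff forall_3 vector_3)
    then show ?thesis unfolding space_A_def limit_arc_def by force
  qed
  define q where "q = e 0"
  have q: "q \<in> topspace R" "q \<in> U"
    unfolding q_def using oA U openin_subset[OF U(1)] by auto
  define I where "I = top_of_set {0..1::real}"
  obtain H where H: "continuous_map (prod_topology R I) R H"
      "\<And>x. x \<in> topspace R \<Longrightarrow> H (x, 0) = q" "\<And>x. x \<in> topspace R \<Longrightarrow> H (x, 1) = x"
      "\<And>s. s \<in> {0..1} \<Longrightarrow> H (q, s) = q"
    using absolute_retract_contracts_to_point[OF R q(1)] unfolding I_def by blast
  have "openin (prod_topology R I) {w \<in> topspace (prod_topology R I). H w \<in> U}"
    using openin_continuous_map_preimage[OF H(1) U(1)] .
  moreover have "compactin I {0..1}"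
    unfolding I_def by (simp add: compactin_subtopology)
  moreover have "{q} \<times> {0..1} \<subseteq> {w \<in> topspace (prod_topology R I). H w \<in> U}"
    using q H(4) by (auto simp: I_def)
  ultimately obtain W J where WJ: "openin R W" "q \<in> W" "{0..1} \<subseteq> J"
      "W \<times> J \<subseteq> {w \<in> topspace (prod_topology R I). H w \<in> U}"
    using tube_lemma_right[of R I _ "{0..1}" q] q(1) by meson
  have W: "H (x, s) \<in> U" if "x \<in> W" "s \<in> {0..1}" for x s
    using WJ that by blast
  have "openin (top_of_set ?A) {a \<in> ?A. e a \<in> W}"
    using openin_continuous_map_preimage[OF e WJ(1)] by simp
  moreover have "0 \<in> {a \<in> ?A. e a \<in> W}"
    using oA WJ(2) unfolding q_def by simp
  ultimately obtain \<epsilon> where \<epsilon>: "\<epsilon> > 0" "\<And>a. a \<in> ?A \<Longrightarrow> norm a < \<epsilon> \<Longrightarrow> e a \<in> W"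
    unfolding openin_contains_ball by (force simp: dist_norm)
  \<comment> \<open>At the radius \<open>1 / (n * pi)\<close> the surface has height \<open>0\<close>, so the circle there is as close to the
    origin as its radius.\<close>
  obtain n :: nat where n: "real n > 1 / \<epsilon> + 1 / r0"
    using reals_Archimedean2 by blast
  define r1 where "r1 = 1 / (real n * pi)"
  have npos: "real n > 0"
    using n \<epsilon>(1) assms(1) by (smt (verit) divide_pos_pos)
  have r1: "r1 > 0" "r1 < r0" "r1 < \<epsilon>"
  proof -
    have "1 / \<epsilon> < real n * pi" "1 / r0 < real n * pi"
    proof -
      have "real n * 1 \<le> real n * pi" using pi_gt3 by (intro mult_left_mono) auto
      moreover have "1 / \<epsilon> > 0" "1 / r0 > 0" using \<epsilon>(1) assms(1) by auto
      ultimately show "1 / \<epsilon> < real n * pi" "1 / r0 < real n * pi" using n by linarith+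
    qed
    then show "r1 < r0" "r1 < \<epsilon>"
      unfolding r1_def using \<epsilon>(1) assms(1) npos by (simp_all add: field_simps)
    show "r1 > 0" unfolding r1_def using npos by simp
  qed
  have small: "e (surface_circle r1 t) \<in> W" if "cmod t = 1" for t
  proof (rule \<epsilon>(2))
    show "surface_circle r1 t \<in> ?A" using surface_circle_in_space that r1 by simp
    have "sin (1 / r1) = 0" unfolding r1_def by simp
    then have "norm (surface_circle r1 t) = sqrt ((r1 * Re t)\<^sup>2 + (r1 * Im t)\<^sup>2)"
      unfolding norm_vec_def L2_set_def surface_circle_def sum_3 by (simp add: vector_3)
    also have "\<dots> = r1 * cmod t"
      using r1 by (simp add: cmod_def power_mult_distrib real_sqrt_mult flip: distrib_left)
    finally show "norm (surface_circle r1 t) < \<epsilon>" using r1 that by simp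
  qed
  \<comment> \<open>\<open>rad\<close> is the radius of the circle of the surface that is used, \<open>lev\<close> the time of the contraction.
    At most one of them varies at a given absolute value.\<close>
  define D where "D = {t :: complex. 1/4 \<le> cmod t \<and> cmod t \<le> 1}"
  define rad where "rad t = r1 + (r0 - r1) * max 0 (2 * cmod t - 1)" for t :: complex
  define lev where "lev t = max 0 (min 1 (4 * cmod t - 1))" for t :: complex
  define f where "f t = surface_circle (rad t) (t / of_real (cmod t))" for t :: complex
  have rad: "0 < rad t" "rad t \<le> r0" if "t \<in> D" for t
  proof -
    have "0 \<le> (r0 - r1) * max 0 (2 * cmod t - 1)" using r1 by simp
    then show "0 < rad t" using r1 unfolding rad_def by linarith
    have "(r0 - r1) * max 0 (2 * cmod t - 1) \<le> (r0 - r1) * 1"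
      using r1 that unfolding D_def by (intro mult_left_mono) auto
    then show "rad t \<le> r0" unfolding rad_def by simp
  qed
  have unit: "cmod (t / of_real (cmod t)) = 1" if "t \<in> D" for t
    using that unfolding D_def by (auto simp: norm_divide)
  have fA: "f t \<in> ?A" if "t \<in> D" for t
    unfolding f_def using surface_circle_in_space[OF unit rad] that by blast
  have "continuous_on D rad" unfolding rad_def by (intro continuous_intros)
  moreover have "continuous_on D (\<lambda>t. t / of_real (cmod t))"
    by (intro continuous_intros) (auto simp: D_def)
  ultimately have "continuous_on D f"
    unfolding f_def using rad by (intro continuous_on_surface_circle) force+
  then have "continuous_map (top_of_set D) (top_of_set ?A) f"
    using fA by auto
  then have ef: "continuous_map (top_of_set D) R (e \<circ> f)"
    using e continuous_map_compose by blast
  have lev01: "lev t \<in> {0..1}" for t unfolding lev_def by auto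
  have "continuous_on D lev" unfolding lev_def by (intro continuous_intros)
  then have "continuous_map (top_of_set D) I lev"
    unfolding I_def using lev01 by auto
  then have "continuous_map (top_of_set D) (prod_topology R I) (\<lambda>t. ((e \<circ> f) t, lev t))"
    using ef by (simp add: continuous_map_paired o_def)
  then have "continuous_map (top_of_set D) R (H \<circ> (\<lambda>t. ((e \<circ> f) t, lev t)))"
    using H(1) continuous_map_compose by blast
  then have HD: "continuous_map (top_of_set D) R (\<lambda>t. H (e (f t), lev t))"
    by (simp add: o_def)
  have efR: "e (f t) \<in> topspace R" if "t \<in> D" for t
    using fA[OF that] U openin_subset[OF U(1)] by blast
  define g where "g = (\<lambda>t. if 1/4 \<le> cmod t then H (e (f t), lev t) else q)"
  have "continuous_map (top_of_set (cball 0 1)) R g"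
    unfolding g_def
  proof (rule continuous_map_cases_le)
    have "subtopology (top_of_set (cball 0 1)) {x \<in> topspace (top_of_set (cball 0 1)). 1/4 \<le> cmod x} =
        top_of_set D"
      unfolding subtopology_subtopology D_def by (rule arg_cong[where f = top_of_set]) auto
    then show "continuous_map (subtopology (top_of_set (cball 0 1))
          {x \<in> topspace (top_of_set (cball 0 1)). 1/4 \<le> cmod x}) R
        (\<lambda>t. H (e (f t), lev t))"
      using HD by simp
    show "H (e (f t), lev t) = q" if "t \<in> topspace (top_of_set (cball 0 1))" "1/4 = cmod t" for t
      using H(2)[OF efR[of t]] that unfolding D_def lev_def by auto
  qed (use q in \<open>auto intro!: continuous_intros\<close>)
  moreover have "g t \<in> V" if "t \<in> cball 0 1" for t
  proof -
    have "H (e (f t), lev t) \<in> U" if "t \<in> D"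
    proof (cases "cmod t \<le> 1/2")
      case True
      then have "rad t = r1" unfolding rad_def by simp
      then have "e (f t) \<in> W" unfolding f_def using small[OF unit[OF that]] by simp
      then show ?thesis using W lev01 by blast
    next
      case False
      then have "lev t = 1" unfolding lev_def by simp
      then show ?thesis using H(3)[OF efR[OF that]] fA[OF that] U(2) by auto
    qed
    then show ?thesis
      using that q(2) U(3) unfolding g_def D_def by auto
  qed
  moreover have "g t = (e \<circ> surface_circle r0) t" if "t \<in> sphere 0 1" for t
  proof -
    have "t \<in> D" "cmod t = 1" using that unfolding D_def by auto
    then show ?thesis
      using H(3)[OF efR[of t]] unfolding g_def lev_def f_def rad_def by simp
  qed
  ultimately show ?thesis
    unfolding nulhomotopic_in_def by (intro exI[of _ g]) (auto simp: continuous_map_in_subtopology)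
qed

theorem corollary3p2:
  fixes r0 :: real and \<rho> \<phi> :: "nat \<Rightarrow> real"
  assumes "r0 > 0"
    and "arc_data r0 \<rho> \<phi>"
  shows "\<not> shape_injective TYPE('b) (top_of_set (space_A r0 \<rho> \<phi>))"
proof
  let ?A = "space_A r0 \<rho> \<phi>"
  assume "shape_injective TYPE('b) (top_of_set ?A)"
  then obtain R :: "'b topology" and e where R: "absolute_retract R"
      and emb: "embedding_map (top_of_set ?A) R e"
      and inj: "\<And>\<gamma>. essential_in (top_of_set ?A) \<gamma> \<Longrightarrow>
           \<exists>V. neighbourhood_in_space R (e ` ?A) V \<and> essential_in (subtopology R V) (e \<circ> \<gamma>)"
    unfolding shape_injective_def by auto
  have e: "continuous_map (top_of_set ?A) R e"
    using emb unfolding embedding_map_def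
    by (meson continuous_map_in_subtopology homeomorphic_imp_continuous_map)
  have "continuous_on (sphere 0 1) (\<lambda>t. surface_circle r0 t)"
    using \<open>r0 > 0\<close> by (intro continuous_on_surface_circle continuous_intros) auto
  then have "closed_curve_in (top_of_set ?A) (surface_circle r0)"
    unfolding closed_curve_in_def using surface_circle_in_space[of _ r0 r0] \<open>r0 > 0\<close> by auto
  then have "essential_in (top_of_set ?A) (surface_circle r0)"
    unfolding essential_in_def using outer_circle_not_nulhomotopic[OF assms] by blast
  then obtain V where "neighbourhood_in_space R (e ` ?A) V" "essential_in (subtopology R V) (e \<circ> surface_circle r0)"
    using inj by blast
  then show False
    using outer_circle_nulhomotopic_near[OF \<open>r0 > 0\<close> R e] unfolding essential_in_def by blast
qed

end
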